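(* Let $\mu\in(0,1)$. There exist a measurable function $d:\mathbb{R}^2\to\mathbb{R}$ with $\|d\|_{L^\infty(\mathbb{R}^2)}=\frac{\pi(1-\mu^2)}{2\mu}$ and a weak solution $u\in W^{1,2}(B_1)$ of $$\operatorname{div}[\mathbf{A}(x)\nabla u]=0\quad\text{in }B_1,$$ such that $\nabla u\notin L^p(B_{1/2})$ for $p\ge\frac{2}{1-\mu}$ and $u\notin C^\alpha(B_{1/2})$ for $\alpha\ge\mu$, where $$\mathbf{A}(x)=\begin{pmatrix}1&0\\0&1\end{pmatrix}+\begin{pmatrix}0&d(x)\\-d(x)&0\end{pmatrix},\qquad x\in\mathbb{R}^2.$$
   Context: $B_\rho\subset\mathbb{R}^2$ denotes the ball of radius $\rho>0$ centered at the origin. A function $u\in W^{1,2}(B_1)$ is a weak solution of $\operatorname{div}[\mathbf{A}\nabla u]=0$ in $B_1$ if $\int_{B_1}\langle\mathbf{A}(x)\nabla u,\nabla\varphi\rangle\,dx=0$ for every smooth function $\varphi$ compactly supported in $B_1$. $C^\alpha(B_{1/2})$ denotes the space of Hölder continuous functions with exponent $\alpha$ on $B_{1/2}$. *)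

theory Defs
  imports "HOL-Probability.Essential_Supremum"
begin

definition partial_deriv :: "'n \<Rightarrow> (real^'n::finite \<Rightarrow> real) \<Rightarrow> real^'n \<Rightarrow> real" where
  "partial_deriv i f x = frechet_derivative f (at x) (axis i 1)"

definition grad :: "(real^'n::finite \<Rightarrow> real) \<Rightarrow> real^'n \<Rightarrow> real^'n" where
  "grad f x = (\<chi> i. partial_deriv i f x)"

primrec Ck :: "nat \<Rightarrow> (real^'n::finite \<Rightarrow> real) \<Rightarrow> bool" where
  "Ck 0 f \<longleftrightarrow> continuous_on UNIV f"
| "Ck (Suc k) f \<longleftrightarrow> (\<forall>x. f differentiable (at x)) \<and> (\<forall>i. Ck k (partial_deriv i f))"

text \<open>A test function on an open set is identified with its extension by zero to the whole space.\<close>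

definition test_functions :: "(real^'n::finite) set \<Rightarrow> (real^'n \<Rightarrow> real) set" where
  "test_functions \<Omega> =
     {\<phi>. (\<forall>k. Ck k \<phi>) \<and> compact (closure {x. \<phi> x \<noteq> 0}) \<and> closure {x. \<phi> x \<noteq> 0} \<subseteq> \<Omega>}"

text \<open>Membership in the Lebesgue space with exponent \<open>p\<close>, meant for \<open>0 < p \<le> \<infinity>\<close>. Only the
  values on \<open>S\<close> matter, and membership is invariant under changes on null sets.\<close>

definition Lp_on ::
  "ereal \<Rightarrow> 'a::euclidean_space set \<Rightarrow> ('a \<Rightarrow> 'b::euclidean_space) set" where
  "Lp_on p S =
     {f \<in> borel_measurable (lebesgue_on S).
        if p = \<infinity> then esssup (lebesgue_on S) (\<lambda>x. ereal (norm (f x))) < \<infinity>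
        else integrable (lebesgue_on S) (\<lambda>x. norm (f x) powr real_of_ereal p)}"

text \<open>The weak gradient is determined by the function only up to null sets, hence a relation.\<close>

definition has_weak_gradient ::
  "(real^'n::finite) set \<Rightarrow> (real^'n \<Rightarrow> real) \<Rightarrow> (real^'n \<Rightarrow> real^'n) \<Rightarrow> bool" where
  "has_weak_gradient \<Omega> u Du \<longleftrightarrow>
     (\<forall>K. compact K \<and> K \<subseteq> \<Omega> \<longrightarrow> set_integrable lebesgue K u \<and> set_integrable lebesgue K Du) \<and>
     (\<forall>\<phi>\<in>test_functions \<Omega>. \<forall>i.
        (LINT x:\<Omega>|lebesgue. u x * partial_deriv i \<phi> x) = - (LINT x:\<Omega>|lebesgue. Du x $ i * \<phi> x))"

text \<open>\<open>in_W12 \<Omega> u Du\<close>: \<open>u\<close> lies in the Sobolev space of order one and exponent two on \<open>\<Omega>\<close>, and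
  \<open>Du\<close> is (a representative of) its weak gradient.\<close>

definition in_W12 ::
  "(real^'n::finite) set \<Rightarrow> (real^'n \<Rightarrow> real) \<Rightarrow> (real^'n \<Rightarrow> real^'n) \<Rightarrow> bool" where
  "in_W12 \<Omega> u Du \<longleftrightarrow> u \<in> Lp_on 2 \<Omega> \<and> Du \<in> Lp_on 2 \<Omega> \<and> has_weak_gradient \<Omega> u Du"

definition weak_solution ::
  "(real^'n::finite \<Rightarrow> real^'n^'n) \<Rightarrow> (real^'n) set \<Rightarrow> (real^'n \<Rightarrow> real) \<Rightarrow> (real^'n \<Rightarrow> real^'n) \<Rightarrow> bool" where
  "weak_solution A \<Omega> u Du \<longleftrightarrow> in_W12 \<Omega> u Du \<and>
     (\<forall>\<phi>\<in>test_functions \<Omega>. (LINT x:\<Omega>|lebesgue. (A x *v Du x) \<bullet> grad \<phi> x) = 0)"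

text \<open>Hoelder continuity on \<open>S\<close> of an element of a Lebesgue space, i.e. of some representative
  modulo null sets. On a bounded set the Hoelder condition already implies boundedness.\<close>

definition in_holder :: "real \<Rightarrow> 'a::euclidean_space set \<Rightarrow> ('a \<Rightarrow> real) \<Rightarrow> bool" where
  "in_holder \<alpha> S u \<longleftrightarrow>
     (\<exists>v. (AE x in lebesgue_on S. v x = u x) \<and>
          (\<exists>C. \<forall>x\<in>S. \<forall>y\<in>S. \<bar>v x - v y\<bar> \<le> C * dist x y powr \<alpha>))"

end

theory Submission
  imports Defs
begin

text \<open>
  Let \<open>M = pi (1 - \<mu>\<^sup>2) / (2 \<mu>)\<close> be the prescribed norm and let \<open>d\<close> be the checkerboard
  coefficient equal to \<open>M\<close> in the first and third quadrants and to \<open>-M\<close> in the other two. The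
  function \<open>u(x, y) = Im ((\<bar>x\<bar> + i y)\<^sup>\<nu>)\<close> is harmonic off the axis \<open>x = 0\<close>, and if
  \<open>cot (\<nu> pi / 2) = M\<close>, then the flux of \<open>u\<close> is a multiple of the rotated gradient of the mirror
  image \<open>u(y, x)\<close>. It is therefore divergence free, so \<open>u\<close> is a weak solution. Jordan's inequality
  shows that \<open>\<nu> < \<mu>\<close> strictly. This excludes also the borderline exponents \<open>\<alpha> = \<mu>\<close> and
  \<open>p = 2 / (1 - \<mu>)\<close>, since \<open>u\<close> is homogeneous of degree \<open>\<nu>\<close> with
  \<open>\<bar>\<nabla>u\<bar> = \<nu> r\<^sup>\<nu>\<^sup>-\<^sup>1\<close>. (The solution \<open>r\<^sup>\<mu> sin \<theta>\<close>, with \<open>d\<close> piecewise linear in the angle, has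
  the same norm of \<open>d\<close>, but it is Hoelder continuous with exponent \<open>\<mu>\<close>.)
\<close>

subsection \<open>Integration along lines and test functions\<close>

text \<open>\<open>t\<close> runs along direction \<open>i\<close> and \<open>s\<close> labels the
  line, so that one parametrisation serves both coordinate directions and each Fubini argument is
  made once, for a general \<open>i\<close>.\<close>

definition pt :: "2 \<Rightarrow> real \<Rightarrow> real \<Rightarrow> real^2" where
  "pt i t s = (\<chi> j. if j = i then t else s)"

lemma pt_nth [simp]: "pt i t s $ j = (if j = i then t else s)"
  by (simp add: pt_def)

lemma pt_eq_line: "pt i t s = pt i 0 s + t *\<^sub>R axis i 1"
  by (simp add: vec_eq_iff axis_def)

lemma continuous_on_pt [continuous_intros]:
  assumes "continuous_on S f" "continuous_on S g"
  shows "continuous_on S (\<lambda>x. pt i (f x) (g x))"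
  unfolding pt_def
proof (rule continuous_on_vec_lambda)
  show "continuous_on S (\<lambda>x. if j = i then f x else g x)" for j
    using assms by (cases "j = i") simp_all
qed

lemma norm_vec2: "norm (x :: real^2) = sqrt ((x$1)\<^sup>2 + (x$2)\<^sup>2)"
  by (simp add: norm_vec_def L2_set_def sum_2)

lemma norm_pt: "norm (pt i t s) = sqrt (t\<^sup>2 + s\<^sup>2)"
  using exhaust_2[of i] by (auto simp: norm_vec2)

lemma borel_measurable_pt [measurable]:
  "(\<lambda>p. pt i (fst p) (snd p)) \<in> borel_measurable borel"
  by (rule borel_measurable_continuous_onI) (intro continuous_on_pt continuous_on_fst continuous_on_snd continuous_on_id)

text \<open>The preimage of a box is a rectangle with the same side lengths, in one order or the
  other. Transporting integrals through this identity gives Fubini's theorem along lines of either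
  direction.\<close>

lemma lborel_eq_distr_pt:
  "(lborel :: (real^2) measure) = distr lborel borel (\<lambda>p. pt i (fst p) (snd p))"
proof (rule lborel_eqI)
  define j where "j = (if i = 1 then 2 else 1 :: 2)"
  fix l u :: "real^2"
  assume le: "\<And>b. b \<in> Basis \<Longrightarrow> l \<bullet> b \<le> u \<bullet> b"
  have lu: "l $ j \<le> u $ j" for j
    using le[of "axis j 1"] by (simp add: inner_axis)
  have vim: "(\<lambda>p. pt i (fst p) (snd p)) -` box l u = {l $ i<..<u $ i} \<times> {l $ j<..<u $ j}"
    using exhaust_2[of i] by (auto simp: mem_box_cart forall_2 j_def)
  have "emeasure (distr lborel borel (\<lambda>p. pt i (fst p) (snd p))) (box l u)
      = emeasure (lborel \<Otimes>\<^sub>M lborel) ({l $ i<..<u $ i} \<times> {l $ j<..<u $ j})"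
    by (simp add: emeasure_distr vim lborel_prod)
  also have "\<dots> = ennreal ((u $ i - l $ i) * (u $ j - l $ j))"
    using lu by (simp add: lborel.emeasure_pair_measure_Times ennreal_mult')
  also have "(u $ i - l $ i) * (u $ j - l $ j) = (u $ 1 - l $ 1) * (u $ 2 - l $ 2)"
    using exhaust_2[of i] by (auto simp: j_def)
  also have "\<dots> = (\<Prod>b\<in>Basis. (u - l) \<bullet> b)"
    by (simp add: Basis_vec_def UNIV_2 inner_axis axis_eq_axis)
  finally show "emeasure (distr lborel borel (\<lambda>p. pt i (fst p) (snd p))) (box l u)
      = ennreal (\<Prod>b\<in>Basis. (u - l) \<bullet> b)" .
qed simp

lemma integrable_pt_iff:
  fixes f :: "real^2 \<Rightarrow> real"
  assumes [measurable]: "f \<in> borel_measurable borel"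
  shows "integrable lborel f \<longleftrightarrow> integrable (lborel \<Otimes>\<^sub>M lborel) (\<lambda>(t, s). f (pt i t s))"
proof -
  have "(\<lambda>(t, s). f (pt i t s)) = (\<lambda>p. f (pt i (fst p) (snd p)))" by auto
  then show ?thesis
    by (subst lborel_eq_distr_pt[of i]) (simp add: integrable_distr_eq lborel_prod)
qed

text \<open>Fubini: the inner integral vanishes for almost every \<open>s\<close>. The exempted line
  \<open>s = 0\<close> is a coordinate axis, where the functions used later have kinks and, at the
  origin, singular gradients.\<close>

lemma integral_zero_on_lines:
  fixes f :: "real^2 \<Rightarrow> real"
  assumes f: "integrable lborel f"
    and lines: "\<And>s. s \<noteq> 0 \<Longrightarrow> ((\<lambda>t. f (pt i t s)) has_integral 0) UNIV"
  shows "integral\<^sup>L lborel f = 0"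
proof -
  have [measurable]: "f \<in> borel_measurable borel"
    using borel_measurable_integrable[OF f] by simp
  have int: "integrable (lborel \<Otimes>\<^sub>M lborel) (\<lambda>(t, s). f (pt i t s))"
    using f integrable_pt_iff by auto
  have "integral\<^sup>L lborel f = (\<integral>p. f (pt i (fst p) (snd p)) \<partial>lborel)"
    by (subst lborel_eq_distr_pt[of i]) (simp add: integral_distr)
  also have "\<dots> = integral\<^sup>L (lborel \<Otimes>\<^sub>M lborel) (\<lambda>(t, s). f (pt i t s))"
    unfolding lborel_prod by (rule arg_cong[of _ _ "integral\<^sup>L lborel"]) auto
  also have "\<dots> = (\<integral>s. (\<integral>t. f (pt i t s) \<partial>lborel) \<partial>lborel)"
    using lborel_pair.integral_snd[OF int] by simp
  also have "\<dots> = (\<integral>s. 0 \<partial>(lborel :: real measure))"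
  proof (rule integral_cong_AE)
    have "AE s in (lborel :: real measure). s \<noteq> 0"
      by (rule AE_lborel_singleton)
    then show "AE s in lborel. (\<integral>t. f (pt i t s) \<partial>lborel) = 0"
    proof eventually_elim
      case (elim s)
      show ?case
      \<comment> \<open>A slice that is not integrable has Lebesgue integral 0 by convention, which
        is the wanted value.\<close>
      proof (cases "integrable lborel (\<lambda>t. f (pt i t s))")
        case True
        then show ?thesis
          using has_integral_integral_lborel[OF True] lines[OF elim] has_integral_unique by blast
      qed (simp add: not_integrable_integral_eq)
    qed
    have "(\<lambda>p. f (pt i (snd p) (fst p))) \<in> borel_measurable (lborel \<Otimes>\<^sub>M lborel)"
      unfolding lborel_prod
      by (rule measurable_compose[of _ _ borel])
         (auto intro!: borel_measurable_continuous_onI continuous_intros)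
    then show "(\<lambda>s. \<integral>t. f (pt i t s) \<partial>lborel) \<in> borel_measurable lborel"
      by (intro lborel.borel_measurable_lebesgue_integral) (simp add: case_prod_beta)
  qed simp
  finally show ?thesis by simp
qed

lemma has_derivative_line:
  assumes "f differentiable (at (z + t *\<^sub>R axis i 1))"
  shows "((\<lambda>t. f (z + t *\<^sub>R axis i 1)) has_real_derivative partial_deriv i f (z + t *\<^sub>R axis i 1)) (at t)"
proof -
  let ?D = "frechet_derivative f (at (z + t *\<^sub>R axis i 1))"
  have D: "(f has_derivative ?D) (at (z + t *\<^sub>R axis i 1))"
    using assms frechet_derivative_works by blast
  have "((\<lambda>t. z + t *\<^sub>R axis i 1) has_derivative (\<lambda>h. h *\<^sub>R axis i 1)) (at t)"
    by (auto intro!: derivative_eq_intros)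
  from diff_chain_at[OF this] D
  have "((\<lambda>t. f (z + t *\<^sub>R axis i 1)) has_derivative (\<lambda>h. ?D (h *\<^sub>R axis i 1))) (at t)"
    by (simp add: o_def)
  also have "(\<lambda>h. ?D (h *\<^sub>R axis i 1)) = (*) (partial_deriv i f (z + t *\<^sub>R axis i 1))"
    using linear_cmul[OF has_derivative_linear[OF D]] by (auto simp: partial_deriv_def fun_eq_iff)
  finally show ?thesis
    by (simp add: has_field_derivative_def)
qed

section \<open>Symmetry of second derivatives\<close>

text \<open>The mean value theorem is applied twice: in direction \<open>i\<close> to the increment
  \<open>g\<close> of \<open>f\<close> across the step \<open>h\<close> along \<open>j\<close>, then
  in direction \<open>j\<close> to \<open>partial_deriv i f\<close>. The second difference on the
  left is symmetric in \<open>i\<close> and \<open>j\<close>.\<close>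

lemma mixed_difference:
  fixes f :: "real^'n::finite \<Rightarrow> real"
  assumes f: "\<And>x. f differentiable (at x)"
    and fi: "\<And>x. partial_deriv i f differentiable (at x)" and "h > 0"
  shows "\<exists>s t. 0 < s \<and> s < h \<and> 0 < t \<and> t < h \<and>
    f (a + h *\<^sub>R axis i 1 + h *\<^sub>R axis j 1) - f (a + h *\<^sub>R axis i 1) - f (a + h *\<^sub>R axis j 1) + f a
      = h * (h * partial_deriv j (partial_deriv i f) (a + s *\<^sub>R axis i 1 + t *\<^sub>R axis j 1))"
proof -
  define g where "g s = f (a + h *\<^sub>R axis j 1 + s *\<^sub>R axis i 1) - f (a + s *\<^sub>R axis i 1)" for s
  have "(g has_real_derivative partial_deriv i f (a + h *\<^sub>R axis j 1 + s *\<^sub>R axis i 1)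
          - partial_deriv i f (a + s *\<^sub>R axis i 1)) (at s)" for s
    unfolding g_def by (intro DERIV_diff has_derivative_line f)
  from MVT2[OF \<open>h > 0\<close> this] obtain s where s: "0 < s" "s < h"
    and gs: "g h - g 0 = h * (partial_deriv i f (a + h *\<^sub>R axis j 1 + s *\<^sub>R axis i 1)
          - partial_deriv i f (a + s *\<^sub>R axis i 1))"
    by auto
  from MVT2[OF \<open>h > 0\<close> has_derivative_line[where f="partial_deriv i f" and i=j and z="a + s *\<^sub>R axis i 1", OF fi]] obtain t where "0 < t" "t < h"
    "partial_deriv i f (a + s *\<^sub>R axis i 1 + h *\<^sub>R axis j 1) - partial_deriv i f (a + s *\<^sub>R axis i 1)
      = h * partial_deriv j (partial_deriv i f) (a + s *\<^sub>R axis i 1 + t *\<^sub>R axis j 1)"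
    by auto
  with s gs show ?thesis
    by (intro exI[of _ s] exI[of _ t]) (auto simp: g_def algebra_simps)
qed

text \<open>Schwarz's theorem: both orders of differentiation represent the same second difference
  over a small square at \<open>a\<close>, each at some point of that square, and both mixed
  derivatives are continuous at \<open>a\<close>.\<close>

lemma partial_deriv_commute:
  fixes f :: "real^'n::finite \<Rightarrow> real"
  assumes "\<And>k. Ck k f"
  shows "partial_deriv i (partial_deriv j f) a = partial_deriv j (partial_deriv i f) a"
proof (rule ccontr)
  let ?A = "partial_deriv i (partial_deriv j f)" and ?B = "partial_deriv j (partial_deriv i f)"
  assume ne: "?A a \<noteq> ?B a"
  have f: "f differentiable (at x)" for x using assms[of 1] by simp
  have fi: "partial_deriv k f differentiable (at x)" for k x
    using assms[of "Suc (Suc 0)"] by auto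
  have "continuous_on UNIV (partial_deriv k (partial_deriv l f))" for k l
    using assms[of "Suc (Suc 0)"] by auto
  then have cont: "isCont (partial_deriv k (partial_deriv l f)) a" for k l
    by (simp add: continuous_on_eq_continuous_at)
  \<comment> \<open>Half the gap: a value within \<open>e\<close> of \<open>?A a\<close> cannot
    equal a value within \<open>e\<close> of \<open>?B a\<close>.\<close>
  define e where "e = \<bar>?A a - ?B a\<bar> / 2"
  have e: "e > 0" using ne by (simp add: e_def)
  obtain d1 where d1: "d1 > 0" "\<And>x. dist x a < d1 \<Longrightarrow> \<bar>?A x - ?A a\<bar> < e"
    using cont[of i j] e unfolding continuous_at_eps_delta dist_real_def by blast
  obtain d2 where d2: "d2 > 0" "\<And>x. dist x a < d2 \<Longrightarrow> \<bar>?B x - ?B a\<bar> < e"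
    using cont[of j i] e unfolding continuous_at_eps_delta dist_real_def by blast
  define h where "h = min d1 d2 / 2"
  have h: "h > 0" "2 * h \<le> d1" "2 * h \<le> d2" using d1 d2 by (auto simp: h_def)
  have near: "dist (a + s *\<^sub>R axis k 1 + t *\<^sub>R axis l 1) a < 2 * h"
    if "0 < s" "s < h" "0 < t" "t < h" for s t k l
  proof -
    have "norm (s *\<^sub>R axis k 1 + t *\<^sub>R axis l (1::real)) \<le> s + t"
      using norm_triangle_ineq[of "s *\<^sub>R axis k (1::real)" "t *\<^sub>R axis l 1"] that by simp
    then show ?thesis using that by (simp add: dist_norm add.assoc)
  qed
  obtain s t where A: "0 < s" "s < h" "0 < t" "t < h"
    "f (a + h *\<^sub>R axis j 1 + h *\<^sub>R axis i 1) - f (a + h *\<^sub>R axis j 1) - f (a + h *\<^sub>R axis i 1) + f a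
      = h * (h * ?A (a + s *\<^sub>R axis j 1 + t *\<^sub>R axis i 1))"
    using mixed_difference[OF f fi \<open>h > 0\<close>, of a j i] by blast
  obtain s' t' where B: "0 < s'" "s' < h" "0 < t'" "t' < h"
    "f (a + h *\<^sub>R axis i 1 + h *\<^sub>R axis j 1) - f (a + h *\<^sub>R axis i 1) - f (a + h *\<^sub>R axis j 1) + f a
      = h * (h * ?B (a + s' *\<^sub>R axis i 1 + t' *\<^sub>R axis j 1))"
    using mixed_difference[OF f fi \<open>h > 0\<close>, of a i j] by blast
  have "h * (h * ?A (a + s *\<^sub>R axis j 1 + t *\<^sub>R axis i 1)) = h * (h * ?B (a + s' *\<^sub>R axis i 1 + t' *\<^sub>R axis j 1))"
    unfolding A(5)[symmetric] B(5)[symmetric] by (simp add: algebra_simps)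
  then have "?A (a + s *\<^sub>R axis j 1 + t *\<^sub>R axis i 1) = ?B (a + s' *\<^sub>R axis i 1 + t' *\<^sub>R axis j 1)"
    using h by simp
  moreover have "\<bar>?A (a + s *\<^sub>R axis j 1 + t *\<^sub>R axis i 1) - ?A a\<bar> < e"
    using near[OF A(1-4), of j i] h by (intro d1) linarith
  moreover have "\<bar>?B (a + s' *\<^sub>R axis i 1 + t' *\<^sub>R axis j 1) - ?B a\<bar> < e"
    using near[OF B(1-4), of i j] h by (intro d2) linarith
  moreover have "\<bar>?A a - ?B a\<bar> = 2 * e" by (simp add: e_def)
  ultimately show False by linarith
qed

section \<open>Test functions and their integrals\<close>

lemma partial_deriv_zero_off_support:
  assumes "x \<notin> closure {x. f x \<noteq> 0}"
  shows "partial_deriv i f x = 0"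
proof -
  have "(f has_derivative (\<lambda>_. 0)) (at x)"
  proof (rule has_derivative_transform_within_open)
    show "((\<lambda>_. 0) has_derivative (\<lambda>_. 0)) (at x)" by simp
    show "open (- closure {x. f x \<noteq> 0})" by auto
    show "0 = f y" if "y \<in> - closure {x. f x \<noteq> 0}" for y
      using that closure_subset[of "{x. f x \<noteq> 0}"] by auto
  qed (use assms in auto)
  then show ?thesis
    by (simp add: partial_deriv_def frechet_derivative_at[symmetric])
qed

text \<open>Allows a derivative of a test function to be inserted into an integration by parts, so
  that second derivatives can be reached. Differentiation does not enlarge the closed
  support.\<close>

lemma test_functions_partial_deriv:
  assumes "\<phi> \<in> test_functions \<Omega>"
  shows "partial_deriv i \<phi> \<in> test_functions \<Omega>"
proof -
  have "{x. partial_deriv i \<phi> x \<noteq> 0} \<subseteq> closure {x. \<phi> x \<noteq> 0}"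
    using partial_deriv_zero_off_support by blast
  then have sub: "closure {x. partial_deriv i \<phi> x \<noteq> 0} \<subseteq> closure {x. \<phi> x \<noteq> 0}"
    by (rule closure_minimal) simp
  have "Ck k (partial_deriv i \<phi>)" for k
  proof -
    have "Ck (Suc k) \<phi>" using assms by (simp add: test_functions_def del: Ck.simps)
    then show ?thesis by simp
  qed
  moreover have "compact (closure {x. partial_deriv i \<phi> x \<noteq> 0})"
    using compact_Int_closed[OF _ closed_closure, of "closure {x. \<phi> x \<noteq> 0}" "{x. partial_deriv i \<phi> x \<noteq> 0}"]
      assms sub by (simp add: test_functions_def Int_absorb1)
  ultimately show ?thesis
    using assms sub by (auto simp: test_functions_def)
qed

lemma test_function_continuous:
  assumes "\<phi> \<in> test_functions \<Omega>"
  shows "continuous_on UNIV \<phi>"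
proof -
  have "Ck 0 \<phi>" using assms by (simp add: test_functions_def del: Ck.simps)
  then show ?thesis by simp
qed

lemma test_function_zero: "\<phi> \<in> test_functions \<Omega> \<Longrightarrow> x \<notin> \<Omega> \<Longrightarrow> \<phi> x = 0"
  using closure_subset[of "{x. \<phi> x \<noteq> 0}"] by (auto simp: test_functions_def)

lemma test_function_bounded:
  assumes "\<phi> \<in> test_functions \<Omega>"
  obtains B where "\<And>x. \<bar>\<phi> x\<bar> \<le> B"
proof -
  have "compact (\<phi> ` closure {x. \<phi> x \<noteq> 0})"
    using assms test_function_continuous
    by (intro compact_continuous_image) (auto simp: test_functions_def intro: continuous_on_subset)
  then obtain B where B: "\<And>x. x \<in> closure {x. \<phi> x \<noteq> 0} \<Longrightarrow> \<bar>\<phi> x\<bar> \<le> B"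
    using compact_imp_bounded bounded_iff by (metis imageI real_norm_def)
  have "\<bar>\<phi> x\<bar> \<le> max B 0" for x
    using B[of x] closure_subset[of "{x. \<phi> x \<noteq> 0}"] by (cases "\<phi> x = 0") auto
  then show ?thesis using that by blast
qed

lemma integrable_mult_test_function:
  fixes F :: "real^'n::finite \<Rightarrow> real"
  assumes "\<phi> \<in> test_functions \<Omega>" "set_integrable lborel \<Omega> F"
  shows "integrable lborel (\<lambda>x. F x * \<phi> x)"
proof -
  obtain B where B: "\<And>x. \<bar>\<phi> x\<bar> \<le> B" using test_function_bounded assms by blast
  have eq: "F x * \<phi> x = indicator \<Omega> x *\<^sub>R F x * \<phi> x" for x
    using test_function_zero[OF assms(1), of x] by (cases "x \<in> \<Omega>") auto
  have [measurable]: "\<phi> \<in> borel_measurable borel"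
    by (intro borel_measurable_continuous_onI test_function_continuous[OF assms(1)])
  have int: "integrable lborel (\<lambda>x. indicator \<Omega> x *\<^sub>R F x)"
    using assms(2) by (simp add: set_integrable_def)
  have [measurable]: "(\<lambda>x. indicator \<Omega> x *\<^sub>R F x) \<in> borel_measurable borel"
    using borel_measurable_integrable[OF int] by simp
  show ?thesis
    unfolding eq
  proof (rule Bochner_Integration.integrable_bound)
    show "integrable lborel (\<lambda>x. B * (indicator \<Omega> x *\<^sub>R F x))"
      using int by (rule integrable_mult_right)
    show "AE x in lborel. norm (indicator \<Omega> x *\<^sub>R F x * \<phi> x) \<le> norm (B * (indicator \<Omega> x *\<^sub>R F x))"
    proof (rule AE_I2)
      fix x
      have "\<bar>indicator \<Omega> x *\<^sub>R F x\<bar> * \<bar>\<phi> x\<bar> \<le> \<bar>indicator \<Omega> x *\<^sub>R F x\<bar> * \<bar>B\<bar>"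
        using B[of x] by (intro mult_left_mono) auto
      then show "norm (indicator \<Omega> x *\<^sub>R F x * \<phi> x) \<le> norm (B * (indicator \<Omega> x *\<^sub>R F x))"
        by (simp only: real_norm_def abs_mult mult.commute)
    qed
  qed measurable
qed

text \<open>The definitions integrate over \<Omega> against \<open>lebesgue\<close>, while the
  Fubini argument works with \<open>lborel\<close> on the whole space. Since \<phi> vanishes off
  \<Omega>, the two integrals agree.\<close>

lemma set_lebesgue_integral_test_function:
  fixes F :: "real^'n::finite \<Rightarrow> real"
  assumes "\<phi> \<in> test_functions \<Omega>" "set_integrable lborel \<Omega> F"
  shows "(LINT x:\<Omega>|lebesgue. F x * \<phi> x) = (LINT x|lborel. F x * \<phi> x)"
    "set_integrable lebesgue \<Omega> (\<lambda>x. F x * \<phi> x)"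
proof -
  have eq: "indicator \<Omega> x *\<^sub>R (F x * \<phi> x) = F x * \<phi> x" for x
    using test_function_zero[OF assms(1), of x] by (cases "x \<in> \<Omega>") auto
  have int: "integrable lborel (\<lambda>x. F x * \<phi> x)"
    by (rule integrable_mult_test_function[OF assms])
  show "(LINT x:\<Omega>|lebesgue. F x * \<phi> x) = (LINT x|lborel. F x * \<phi> x)"
    unfolding set_lebesgue_integral_def eq
    using borel_measurable_integrable[OF int] by (rule integral_completion)
  show "set_integrable lebesgue \<Omega> (\<lambda>x. F x * \<phi> x)"
    unfolding set_integrable_def eq
    using int integrable_completion[OF borel_measurable_integrable[OF int]] by simp
qed

text \<open>On every line \<open>s \<noteq> 0\<close> the function \<open>F * \<phi>\<close> is
  continuous, vanishes outside the ball and is differentiable except perhaps at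
  \<open>t = 0\<close>, so its derivative integrates to zero. Fubini then gives the integration by
  parts.\<close>

lemma weak_partial_deriv_by_lines:
  fixes F G \<phi> :: "real^2 \<Rightarrow> real"
  assumes \<phi>: "\<phi> \<in> test_functions (ball 0 1)"
    and F: "set_integrable lborel (ball 0 1) F" and G: "set_integrable lborel (ball 0 1) G"
    and cont: "\<And>s. s \<noteq> 0 \<Longrightarrow> continuous_on UNIV (\<lambda>t. F (pt i t s))"
    and deriv: "\<And>s t. s \<noteq> 0 \<Longrightarrow> t \<noteq> 0 \<Longrightarrow>
      ((\<lambda>t. F (pt i t s)) has_real_derivative G (pt i t s)) (at t)"
  shows "(LINT x:ball 0 1|lebesgue. F x * partial_deriv i \<phi> x)
     = - (LINT x:ball 0 1|lebesgue. G x * \<phi> x)"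
proof -
  note D = test_functions_partial_deriv[OF \<phi>, of i]
  let ?H = "\<lambda>x. F x * partial_deriv i \<phi> x + G x * \<phi> x"
  have int1: "integrable lborel (\<lambda>x. F x * partial_deriv i \<phi> x)"
    by (rule integrable_mult_test_function[OF D F])
  have int2: "integrable lborel (\<lambda>x. G x * \<phi> x)"
    by (rule integrable_mult_test_function[OF \<phi> G])
  have line: "((\<lambda>t. ?H (pt i t s)) has_integral 0) UNIV" if s: "s \<noteq> 0" for s
  proof -
    have out: "pt i t s \<notin> ball 0 1" if "t \<notin> {-1<..<1}" for t
    proof -
      have "1 \<le> \<bar>t\<bar>" using that by auto
      then have "1 \<le> t\<^sup>2" using power_mono[of 1 "\<bar>t\<bar>" 2] by simp
      then have "1 \<le> t\<^sup>2 + s\<^sup>2" by (simp add: add_increasing2)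
      then have "1 \<le> sqrt (t\<^sup>2 + s\<^sup>2)" by simp
      then show ?thesis by (simp add: norm_pt)
    qed
    have diff: "\<phi> differentiable (at x)" for x
    proof -
      have "Ck (Suc 0) \<phi>" using \<phi> by (simp add: test_functions_def del: Ck.simps)
      then show ?thesis by simp
    qed
    have d\<phi>: "((\<lambda>t. \<phi> (pt i t s)) has_real_derivative partial_deriv i \<phi> (pt i t s)) (at t)" for t
      using has_derivative_line[where f=\<phi> and z="pt i 0 s" and t=t and i=i, OF diff] unfolding pt_eq_line[of i _ s, symmetric] .
    \<comment> \<open>This form of the fundamental theorem tolerates the exceptional point 0, where
      \<open>F\<close> is only continuous. The boundary terms sit at \<open>t = 1\<close> and
      \<open>t = -1\<close>, outside the open ball, and so vanish.\<close>
    have "((\<lambda>t. ?H (pt i t s)) has_integral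
        F (pt i 1 s) * \<phi> (pt i 1 s) - F (pt i (-1) s) * \<phi> (pt i (-1) s)) {-1..1}"
    proof (rule fundamental_theorem_of_calculus_interior_strong[of "{0}"])
      fix t :: real assume t: "t \<in> {-1<..<1} - {0}"
      show "((\<lambda>t. F (pt i t s) * \<phi> (pt i t s)) has_vector_derivative ?H (pt i t s)) (at t)"
        using DERIV_mult[OF deriv[OF s, of t] d\<phi>[of t]] t
        by (simp add: has_real_derivative_iff_has_vector_derivative algebra_simps)
    next
      show "continuous_on {-1..1} (\<lambda>t. F (pt i t s) * \<phi> (pt i t s))"
        using cont[OF s]
        by (intro continuous_intros continuous_on_compose2[OF test_function_continuous[OF \<phi>]])
           (auto intro: continuous_on_subset)
    qed auto
    moreover have "\<phi> (pt i 1 s) = 0" "\<phi> (pt i (-1) s) = 0"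
      by (rule test_function_zero[OF \<phi> out]; simp)+
    ultimately have "((\<lambda>t. ?H (pt i t s)) has_integral 0) {-1..1}" by simp
    then show ?thesis
    proof (rule has_integral_on_superset)
      show "?H (pt i t s) = 0" if "t \<notin> {-1..1}" for t
      proof -
        have "pt i t s \<notin> ball 0 1" using that by (intro out) auto
        then have "\<phi> (pt i t s) = 0" "partial_deriv i \<phi> (pt i t s) = 0"
          using test_function_zero[OF \<phi>] test_function_zero[OF D] by blast+
        then show ?thesis by simp
      qed
    qed simp
  qed
  have "integral\<^sup>L lborel ?H = 0"
    using integral_zero_on_lines[OF Bochner_Integration.integrable_add[OF int1 int2] line] .
  then show ?thesis
    unfolding set_lebesgue_integral_test_function(1)[OF D F] set_lebesgue_integral_test_function(1)[OF \<phi> G]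
      Bochner_Integration.integral_add[OF int1 int2] by linarith
qed

subsection \<open>The homogeneous solution\<close>

lemma negligible_imp_AE_lborel:
  fixes N :: "'a::euclidean_space set"
  assumes "negligible N" "N \<in> sets borel"
  shows "AE x in lborel. x \<notin> N"
  using assms by (intro AE_not_in) (simp add: negligible_iff_null_sets null_sets_completion_iff)

lemma borel_measurable_vec_nth: "(\<lambda>x :: real^'n::finite. x $ i) \<in> borel_measurable borel"
  by (intro borel_measurable_continuous_onI continuous_intros)

lemma AE_lborel_coord_nonzero: "AE x in (lborel :: (real^'n::finite) measure). x $ k \<noteq> 0"
proof -
  have "closed {x :: real^'n. x $ k = 0}"
    by (intro closed_Collect_eq continuous_intros)
  then show ?thesis
    using negligible_imp_AE_lborel[OF negligible_standard_hyperplane_cart[of k]] by simp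
qed

lemma integrable_abs_powr:
  fixes b :: real
  assumes "b > -1"
  shows "integrable lborel (\<lambda>t. indicator {-1..1} t * \<bar>t\<bar> powr b)"
proof -
  have 1: "(\<lambda>t. \<bar>t\<bar> powr b) integrable_on {0..1}"
    using integrable_on_powr_from_0[OF assms, of 1] by (rule integrable_eq) auto
  then have 2: "(\<lambda>t. \<bar>t\<bar> powr b) integrable_on {-1..0}"
    using Henstock_Kurzweil_Integration.integrable_reflect_real[where f="\<lambda>t. \<bar>t\<bar> powr b" and a="-1" and b=0] by simp
  have "(\<lambda>t. \<bar>t\<bar> powr b) integrable_on {-1..1}"
    by (rule Henstock_Kurzweil_Integration.integrable_combine[OF _ _ 2 1]) auto
  then have "set_integrable lebesgue {-1..1} (\<lambda>t. \<bar>t\<bar> powr b)"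
    by (rule nonnegative_absolutely_integrable_1) auto
  then have "integrable lebesgue (\<lambda>t. indicator {-1..1} t * \<bar>t\<bar> powr b)"
    by (simp add: set_integrable_def)
  moreover have "(\<lambda>t. indicator {-1..1} t * \<bar>t\<bar> powr b) \<in> borel_measurable lborel"
    by measurable
  ultimately show ?thesis
    by (subst (asm) integrable_completion) auto
qed

text \<open>Polar coordinates are avoided. Since
  \<open>\<bar>x$1\<bar> * \<bar>x$2\<bar> \<le> (norm x)\<^sup>2\<close> and
  \<open>a \<le> 0\<close>, the integrand is at most
  \<open>\<bar>x$1\<bar> powr (a/2) * \<bar>x$2\<bar> powr (a/2)\<close> off the axes. This product
  is integrable over the square because \<open>a/2 > -1\<close>.\<close>

lemma integrable_norm_powr_ball:
  fixes a :: real
  assumes a: "-2 < a" "a \<le> 0"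
  shows "set_integrable lborel (ball 0 1) (\<lambda>x :: real^2. norm x powr a)"
proof -
  define h where "h t = indicator {-1..1} t * \<bar>t\<bar> powr (a/2)" for t :: real
  have h: "integrable lborel h"
    unfolding h_def using a by (intro integrable_abs_powr) simp
  have [measurable]: "h \<in> borel_measurable borel"
    using borel_measurable_integrable[OF h] by simp
  have h0: "h t \<ge> 0" for t by (simp add: h_def)
  have "integrable (lborel \<Otimes>\<^sub>M lborel) (\<lambda>(t, s). h t * h s)"
  proof (rule lborel_pair.Fubini_integrable)
    show "integrable lborel (\<lambda>x. LBINT y. norm (case (x, y) of (t, s) \<Rightarrow> h t * h s))"
      using h h0 by (simp add: abs_mult)
    show "AE x in lborel. integrable lborel (\<lambda>y. case (x, y) of (t, s) \<Rightarrow> h t * h s)"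
      using h by simp
  qed measurable
  then have "integrable (lborel \<Otimes>\<^sub>M lborel) (\<lambda>(t, s). h (pt 1 t s $ 1) * h (pt 1 t s $ 2))"
    by simp
  then have int: "integrable lborel (\<lambda>x :: real^2. h (x $ 1) * h (x $ 2))"
    by (subst integrable_pt_iff[where i=1]) auto
  show ?thesis
    unfolding set_integrable_def
  proof (rule Bochner_Integration.integrable_bound[OF int])
    show "AE x in lborel. norm (indicat_real (ball 0 1) x *\<^sub>R norm (x :: real^2) powr a)
        \<le> norm (h (x $ 1) * h (x $ 2))"
      using AE_lborel_coord_nonzero[of 1] AE_lborel_coord_nonzero[of 2]
    proof eventually_elim
      case (elim x)
      show ?case
      proof (cases "x \<in> ball 0 1")
        case True
        then have le: "\<bar>x $ k\<bar> \<le> 1" for k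
          using component_le_norm_cart[of x k] by simp
        have "sqrt (\<bar>x $ 1\<bar> * \<bar>x $ 2\<bar>) \<le> norm x"
        proof -
          have "0 \<le> (\<bar>x $ 1\<bar> - \<bar>x $ 2\<bar>)\<^sup>2 + \<bar>x $ 1\<bar> * \<bar>x $ 2\<bar>" by simp
          then have "\<bar>x $ 1\<bar> * \<bar>x $ 2\<bar> \<le> (x $ 1)\<^sup>2 + (x $ 2)\<^sup>2"
            by (simp add: power2_diff)
          then show ?thesis by (simp add: norm_vec2)
        qed
        then have "norm x powr a \<le> sqrt (\<bar>x $ 1\<bar> * \<bar>x $ 2\<bar>) powr a"
          using elim a by (intro powr_mono2') auto
        also have "\<dots> = \<bar>x $ 1\<bar> powr (a/2) * \<bar>x $ 2\<bar> powr (a/2)"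
          by (simp add: powr_half_sqrt[symmetric] powr_powr powr_mult)
        finally show ?thesis
          using True le by (simp add: h_def abs_le_iff)
      qed simp
    qed
    have [measurable]: "ball 0 1 \<in> sets (borel :: (real^2) measure)" by simp
    show "(\<lambda>x :: real^2. indicat_real (ball 0 1) x *\<^sub>R norm x powr a) \<in> borel_measurable lborel"
      by measurable
  qed
qed

section \<open>The solution and its gradient\<close>

text \<open>In polar coordinates this is \<open>r powr \<nu> * sin (\<nu> * \<theta>)\<close> on the
  right half plane, extended evenly in \<open>x$1\<close>. Folding by the absolute value keeps the
  complex power away from its branch cut.\<close>

definition saddle :: "real \<Rightarrow> real^2 \<Rightarrow> real" where
  "saddle \<nu> x = Im (Complex \<bar>x$1\<bar> (x$2) powr of_real \<nu>)"

text \<open>The complex derivative of the power, written as a quotient. For \<open>\<nu> > 0\<close>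
  the numerator is continuous on the closed right half plane, which yields measurability, and
  division by zero gives the value 0 at the origin.\<close>

definition dpowr :: "real \<Rightarrow> complex \<Rightarrow> complex" where
  "dpowr \<nu> z = of_real \<nu> * (z powr of_real \<nu> / z)"

text \<open>The chain rule for \<open>Complex \<bar>x$1\<bar> (x$2)\<close>, whose partial
  derivatives are \<open>sgn (x$1)\<close> and \<open>\<i>\<close>. On the null set
  \<open>x$1 = 0\<close> the first component is set to 0 by \<open>sgn\<close>.\<close>

definition Dsaddle :: "real \<Rightarrow> real^2 \<Rightarrow> real^2" where
  "Dsaddle \<nu> x = vector [sgn (x$1) * Im (dpowr \<nu> (Complex \<bar>x$1\<bar> (x$2))), Re (dpowr \<nu> (Complex \<bar>x$1\<bar> (x$2)))]"

lemma continuous_on_powr_halfplane: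
  assumes "\<nu> > 0" "continuous_on A f" "\<And>x. x \<in> A \<Longrightarrow> Re (f x) \<ge> 0"
  shows "continuous_on A (\<lambda>x. f x powr of_real \<nu>)"
  using assms by (intro continuous_intros) auto

lemma continuous_on_saddle:
  assumes "\<nu> > 0"
  shows "continuous_on UNIV (saddle \<nu>)"
  unfolding saddle_def Complex_eq using assms
  by (intro continuous_intros continuous_on_powr_halfplane) auto

lemma powr_has_field_derivative_dpowr:
  assumes "z \<noteq> 0" "Re z \<ge> 0"
  shows "((\<lambda>z. z powr of_real \<nu>) has_field_derivative dpowr \<nu> z) (at z)"
proof -
  have "z \<notin> \<real>\<^sub>\<le>\<^sub>0" using assms by (auto simp: complex_nonpos_Reals_iff complex_eq_iff)
  moreover have "z powr (of_real \<nu> - 1) = z powr of_real \<nu> / z"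
    using assms by (simp add: powr_diff)
  ultimately show ?thesis
    using has_field_derivative_powr[of z "of_real \<nu>"] by (simp add: dpowr_def)
qed

lemma norm_dpowr: "\<nu> \<ge> 0 \<Longrightarrow> norm (dpowr \<nu> z) = \<nu> * norm z powr (\<nu> - 1)"
  by (cases "z = 0") (simp_all add: dpowr_def norm_mult norm_divide norm_powr_real_powr' powr_diff)

lemma norm_fold: "norm (Complex \<bar>x$1\<bar> (x$2)) = norm (x :: real^2)"
  by (simp add: norm_vec2 cmod_def)

text \<open>The gradient has the length of the complex derivative, except that on the axis
  \<open>x$1 = 0\<close> the factor \<open>sgn\<close> drops one component. Hence a bound
  everywhere, and equality off the axis.\<close>

lemma norm_Dsaddle_le: "\<nu> \<ge> 0 \<Longrightarrow> norm (Dsaddle \<nu> x) \<le> \<nu> * norm x powr (\<nu> - 1)"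
  and norm_Dsaddle: "\<nu> \<ge> 0 \<Longrightarrow> x$1 \<noteq> 0 \<Longrightarrow> norm (Dsaddle \<nu> x) = \<nu> * norm x powr (\<nu> - 1)"
proof -
  let ?z = "Complex \<bar>x$1\<bar> (x$2)"
  note z = norm_fold[of x]
  have D: "norm (Dsaddle \<nu> x) = sqrt ((sgn (x$1))\<^sup>2 * (Im (dpowr \<nu> ?z))\<^sup>2 + (Re (dpowr \<nu> ?z))\<^sup>2)"
    by (simp add: Dsaddle_def norm_vec2 power_mult_distrib)
  have s: "(sgn (x$1))\<^sup>2 = (if x$1 = 0 then 0 else 1)" by (simp add: sgn_if)
  have E: "norm (dpowr \<nu> ?z) = sqrt ((Im (dpowr \<nu> ?z))\<^sup>2 + (Re (dpowr \<nu> ?z))\<^sup>2)"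
    by (simp add: cmod_def add.commute)
  show "norm (Dsaddle \<nu> x) \<le> \<nu> * norm x powr (\<nu> - 1)" if "\<nu> \<ge> 0"
  proof -
    have "norm (Dsaddle \<nu> x) \<le> norm (dpowr \<nu> ?z)"
      unfolding D E s by (rule real_sqrt_le_mono) simp
    then show ?thesis using norm_dpowr[OF that, of ?z] by (simp only: z)
  qed
  show "norm (Dsaddle \<nu> x) = \<nu> * norm x powr (\<nu> - 1)" if "\<nu> \<ge> 0" "x$1 \<noteq> 0"
    using norm_dpowr[OF that(1), of ?z] that(2) unfolding z E D s by simp
qed

lemma borel_measurable_Dsaddle [measurable]:
  assumes "\<nu> > 0"
  shows "Dsaddle \<nu> \<in> borel_measurable borel"
proof -
  have c: "continuous_on UNIV (\<lambda>x :: real^2. Complex \<bar>x$1\<bar> (x$2))"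
    unfolding Complex_eq by (intro continuous_intros)
  have [measurable]: "(\<lambda>x :: real^2. Complex \<bar>x$1\<bar> (x$2)) \<in> borel_measurable borel"
    using c by (rule borel_measurable_continuous_onI)
  have [measurable]: "(\<lambda>x :: real^2. Complex \<bar>x$1\<bar> (x$2) powr of_real \<nu>) \<in> borel_measurable borel"
    by (intro borel_measurable_continuous_onI continuous_on_powr_halfplane assms c) simp
  have [measurable]: "(\<lambda>x :: real^2. dpowr \<nu> (Complex \<bar>x$1\<bar> (x$2))) \<in> borel_measurable borel"
    unfolding dpowr_def by measurable
  have [measurable]: "(\<lambda>x :: real^2. Im (dpowr \<nu> (Complex \<bar>x$1\<bar> (x$2)))) \<in> borel_measurable borel"
    "(\<lambda>x :: real^2. Re (dpowr \<nu> (Complex \<bar>x$1\<bar> (x$2)))) \<in> borel_measurable borel"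
    by measurable
  have "Dsaddle \<nu> = (\<lambda>x. (sgn (x$1) * Im (dpowr \<nu> (Complex \<bar>x$1\<bar> (x$2)))) *\<^sub>R axis 1 1
      + Re (dpowr \<nu> (Complex \<bar>x$1\<bar> (x$2))) *\<^sub>R axis 2 1)"
    by (auto simp: Dsaddle_def vec_eq_iff forall_2 axis_def fun_eq_iff)
  also have "\<dots> \<in> borel_measurable borel" by measurable
  finally show ?thesis .
qed

lemma saddle_line_deriv:
  assumes "s \<noteq> 0" "t \<noteq> 0"
  shows "((\<lambda>t. saddle \<nu> (pt i t s)) has_real_derivative Dsaddle \<nu> (pt i t s) $ i) (at t)"
proof -
  \<comment> \<open>The line folded into the right half plane, with velocity \<open>c'\<close>.
    Along it \<open>saddle \<nu>\<close> is the imaginary part of the power of \<open>c\<close>, and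
    \<open>s\<close> and \<open>t\<close> being nonzero keeps \<open>c t\<close> off the branch cut
    and makes the absolute value differentiable.\<close>
  define c where "c = (\<lambda>t. if i = 1 then Complex \<bar>t\<bar> s else Complex \<bar>s\<bar> t)"
  define c' where "c' = (if i = 1 then of_real (sgn t) else \<i>)"
  have abs: "((\<lambda>t. \<bar>t\<bar>) has_real_derivative sgn t) (at t)"
  proof (cases "t > 0")
    case True
    then show ?thesis
      using has_field_derivative_transform_within_open[OF DERIV_ident, of "{0<..}" t abs] by simp
  next
    case False
    then show ?thesis
      using has_field_derivative_transform_within_open[OF DERIV_minus[OF DERIV_ident], of "{..<0}" t abs] \<open>t \<noteq> 0\<close>
      by simp
  qed
  have "((\<lambda>t. Complex \<bar>t\<bar> s) has_vector_derivative of_real (sgn t)) (at t)"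
    unfolding Complex_eq
    using has_vector_derivative_add[OF has_vector_derivative_of_real[OF abs] has_vector_derivative_const]
    by simp
  moreover have "((\<lambda>t. Complex \<bar>s\<bar> t) has_vector_derivative \<i>) (at t)"
    unfolding Complex_eq by (auto intro!: derivative_eq_intros)
  ultimately have c: "(c has_vector_derivative c') (at t)"
    by (auto simp: c_def c'_def)
  have "((\<lambda>z. z powr of_real \<nu>) has_field_derivative dpowr \<nu> (c t)) (at (c t))"
    using assms by (intro powr_has_field_derivative_dpowr) (auto simp: c_def complex_eq_iff)
  from field_vector_diff_chain_at[OF c this]
  have "((\<lambda>t. c t powr of_real \<nu>) has_vector_derivative c' * dpowr \<nu> (c t)) (at t)"
    by (simp add: o_def)
  from bounded_linear.has_vector_derivative[OF bounded_linear_Im this]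
  have "((\<lambda>t. Im (c t powr of_real \<nu>)) has_real_derivative Im (c' * dpowr \<nu> (c t))) (at t)"
    by (simp add: has_real_derivative_iff_has_vector_derivative)
  moreover have "saddle \<nu> (pt i t s) = Im (c t powr of_real \<nu>)" for t
    using exhaust_2[of i] by (auto simp: saddle_def c_def)
  moreover have "Im (c' * dpowr \<nu> (c t)) = Dsaddle \<nu> (pt i t s) $ i"
    using exhaust_2[of i] by (auto simp: Dsaddle_def c_def c'_def)
  ultimately show ?thesis by simp
qed

section \<open>Rotation identities and the flux\<close>

lemma dpowr_cnj: "Re z \<ge> 0 \<Longrightarrow> dpowr \<nu> (cnj z) = cnj (dpowr \<nu> z)"
  by (cases "z = 0") (auto simp: dpowr_def cnj_powr complex_eq_iff)

text \<open>The argument of \<open>z\<close> is at most \<open>pi / 2\<close>, so a quarter turn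
  does not carry it past \<open>pi\<close> and the principal logarithm grows by exactly
  \<open>\<i> * pi / 2\<close>.\<close>

lemma powr_of_real_rotate:
  assumes "z \<noteq> 0" "Re z \<ge> 0"
  shows "(\<i> * z) powr of_real \<nu> = cis (\<nu> * pi / 2) * z powr of_real \<nu>"
  using assms by (simp add: powr_def Ln_times_ii distrib_left exp_add cis_conv_exp mult_ac)

lemma dpowr_rotate:
  assumes "z \<noteq> 0" "Re z \<ge> 0"
  shows "dpowr \<nu> (\<i> * z) = - \<i> * cis (\<nu> * pi / 2) * dpowr \<nu> z"
  using assms powr_of_real_rotate[OF assms, of \<nu>] by (simp add: dpowr_def field_simps)

text \<open>Reflection in the diagonal is conjugation followed by a quarter turn.\<close>

lemma dpowr_swap:
  assumes "p > 0" "q > 0"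
  shows "dpowr \<nu> (Complex q p) = - \<i> * cis (\<nu> * pi / 2) * cnj (dpowr \<nu> (Complex p q))"
proof -
  have "Complex q p = \<i> * cnj (Complex p q)" by (simp add: complex_eq_iff)
  moreover have "dpowr \<nu> (\<i> * cnj (Complex p q)) = - \<i> * cis (\<nu> * pi / 2) * dpowr \<nu> (cnj (Complex p q))"
    using assms by (intro dpowr_rotate) (auto simp: complex_eq_iff)
  ultimately show ?thesis
    using assms by (simp only:) (simp add: dpowr_cnj)
qed

definition swap :: "real^2 \<Rightarrow> real^2" where
  "swap x = pt 2 (x$1) (x$2)"

lemma norm_swap [simp]: "norm (swap x) = norm x"
  by (simp add: swap_def norm_pt norm_vec2)

lemma swap_pt: "i \<noteq> j \<Longrightarrow> swap (pt i t s) = pt j t s"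
  using exhaust_2[of i] exhaust_2[of j] by (auto simp: swap_def vec_eq_iff forall_2)

lemma borel_measurable_swap [measurable]: "swap \<in> borel_measurable borel"
  unfolding swap_def by (intro borel_measurable_continuous_onI continuous_intros)

text \<open>If \<open>c = M * s\<close> and \<open>d = M * sgn (x$1 * x$2)\<close>, the right-hand
  sides are \<open>- s\<close> and \<open>s\<close> times the two components of the flux of
  \<open>saddle \<nu>\<close>. The left-hand sides are, with the coordinates exchanged, the partial
  derivatives of the mirror image. So the flux is a rotated gradient.\<close>

lemma Dsaddle_flux:
  fixes x :: "real^2" and \<nu> :: real
  defines "s \<equiv> sin (\<nu> * pi / 2)" and "c \<equiv> cos (\<nu> * pi / 2)"
  assumes "x$1 \<noteq> 0" "x$2 \<noteq> 0"
  shows "Dsaddle \<nu> (swap x) $ 1 = - (s * Dsaddle \<nu> x $ 1 + sgn (x$1 * x$2) * c * Dsaddle \<nu> x $ 2)"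
    and "Dsaddle \<nu> (swap x) $ 2 = s * Dsaddle \<nu> x $ 2 - sgn (x$1 * x$2) * c * Dsaddle \<nu> x $ 1"
proof -
  let ?p = "\<bar>x$1\<bar>" and ?q = "\<bar>x$2\<bar>"
  have cnj: "dpowr \<nu> (Complex a (-b)) = cnj (dpowr \<nu> (Complex a b))" if "a > 0" for a b
    using dpowr_cnj[of "Complex a b" \<nu>] that by (simp add: complex_cnj)
  \<comment> \<open>Conjugation symmetry reduces all four quadrants to the first one, with the signs
    kept as explicit factors.\<close>
  have signs: "dpowr \<nu> (Complex a b) = Complex (Re (dpowr \<nu> (Complex a \<bar>b\<bar>))) (sgn b * Im (dpowr \<nu> (Complex a \<bar>b\<bar>)))"
    if "a > 0" "b \<noteq> 0" for a b
    using that cnj[of a "\<bar>b\<bar>"] by (cases "b > 0") (auto simp: complex_eq_iff)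
  have sw: "dpowr \<nu> (Complex ?q ?p) = - \<i> * cis (\<nu> * pi / 2) * cnj (dpowr \<nu> (Complex ?p ?q))"
    using assms by (intro dpowr_swap) auto
  have re: "Re (dpowr \<nu> (Complex ?q ?p)) = s * Re (dpowr \<nu> (Complex ?p ?q)) - c * Im (dpowr \<nu> (Complex ?p ?q))"
    and im: "Im (dpowr \<nu> (Complex ?q ?p)) = - (c * Re (dpowr \<nu> (Complex ?p ?q)) + s * Im (dpowr \<nu> (Complex ?p ?q)))"
    unfolding sw s_def c_def by (simp_all add: algebra_simps)
  have x: "dpowr \<nu> (Complex ?p (x$2)) = Complex (Re (dpowr \<nu> (Complex ?p ?q))) (sgn (x$2) * Im (dpowr \<nu> (Complex ?p ?q)))"
    using assms by (intro signs) auto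
  have y: "dpowr \<nu> (Complex ?q (x$1)) = Complex (Re (dpowr \<nu> (Complex ?q ?p))) (sgn (x$1) * Im (dpowr \<nu> (Complex ?q ?p)))"
    using assms by (intro signs) auto
  have ss: "sgn (x$2) * sgn (x$2) = 1" "sgn (x$1) * sgn (x$1) = 1"
    using assms by (auto simp: sgn_if)
  show "Dsaddle \<nu> (swap x) $ 1 = - (s * Dsaddle \<nu> x $ 1 + sgn (x$1 * x$2) * c * Dsaddle \<nu> x $ 2)"
    by (simp add: Dsaddle_def swap_def x y re im sgn_mult algebra_simps)
  show "Dsaddle \<nu> (swap x) $ 2 = s * Dsaddle \<nu> x $ 2 - sgn (x$1 * x$2) * c * Dsaddle \<nu> x $ 1"
    using ss by (simp add: Dsaddle_def swap_def x y re im sgn_mult algebra_simps)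

qed

section \<open>Sobolev regularity and the weak equation\<close>

lemma set_integrable_ball_bound:
  fixes g :: "real^2 \<Rightarrow> 'b::{banach, second_countable_topology}"
  assumes [measurable]: "g \<in> borel_measurable borel" and a: "-2 < a" "a \<le> 0"
    and bound: "\<And>x. x \<in> ball 0 1 \<Longrightarrow> norm (g x) \<le> C * norm x powr a"
  shows "set_integrable lborel (ball 0 1) g"
  unfolding set_integrable_def
proof (rule Bochner_Integration.integrable_bound)
  show "integrable lborel (\<lambda>x :: real^2. C * (indicator (ball 0 1) x *\<^sub>R norm x powr a))"
    using integrable_norm_powr_ball[OF a] unfolding set_integrable_def by (rule integrable_mult_right)
  have [measurable]: "ball 0 1 \<in> sets (borel :: (real^2) measure)" by simp
  show "(\<lambda>x. indicat_real (ball 0 1) x *\<^sub>R g x) \<in> borel_measurable lborel"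
    by measurable
  show "AE x in lborel. norm (indicat_real (ball 0 1) x *\<^sub>R g x)
      \<le> norm (C * (indicator (ball 0 1) x *\<^sub>R norm x powr a))"
    using bound by (intro AE_I2) (auto simp: indicator_def intro: order_trans[OF _ abs_ge_self])
qed

lemma set_integrable_lborel_imp_lebesgue:
  fixes g :: "'a::euclidean_space \<Rightarrow> 'b::{banach, second_countable_topology}"
  assumes "set_integrable lborel S g"
  shows "set_integrable lebesgue S g"
  using assms integrable_completion[OF borel_measurable_integrable[OF assms[unfolded set_integrable_def]]]
  by (simp add: set_integrable_def)

lemma Lp_on_2_ball_bound:
  fixes g :: "real^2 \<Rightarrow> 'b::euclidean_space"
  assumes g [measurable]: "g \<in> borel_measurable borel" and a: "-1 < a" "a \<le> 0" and "C \<ge> 0"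
    and bound: "\<And>x. x \<in> ball 0 1 \<Longrightarrow> norm (g x) \<le> C * norm x powr a"
  shows "g \<in> Lp_on 2 (ball 0 1)"
proof -
  have "set_integrable lborel (ball 0 1) (\<lambda>x. norm (g x) powr 2)"
  proof (rule set_integrable_ball_bound)
    show "(\<lambda>x. norm (g x) powr 2) \<in> borel_measurable borel" by measurable
    show "-2 < 2 * a" "2 * a \<le> 0" using a by auto
    show "norm (norm (g x) powr 2) \<le> C\<^sup>2 * norm x powr (2 * a)" if "x \<in> ball 0 1" for x
    proof -
      have "norm (g x) powr 2 \<le> (C * norm x powr a) powr 2"
        using bound[OF that] by (intro powr_mono2) auto
      also have "\<dots> = C\<^sup>2 * norm x powr (2 * a)"
        using \<open>C \<ge> 0\<close> by (simp add: powr_mult powr_powr mult.commute)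
      finally show ?thesis by simp
    qed
  qed
  then have "set_integrable lebesgue (ball 0 1) (\<lambda>x. norm (g x) powr 2)"
    by (rule set_integrable_lborel_imp_lebesgue)
  moreover have "g \<in> borel_measurable (lebesgue_on (ball 0 1))"
    using g by (intro measurable_restrict_space1 measurable_completion) simp
  ultimately show ?thesis
    by (simp add: Lp_on_def set_integrable_def integrable_restrict_space)
qed

lemma abs_saddle_le: "\<bar>saddle \<nu> x\<bar> \<le> norm x powr \<nu>"
proof -
  have "\<bar>saddle \<nu> x\<bar> \<le> norm (Complex \<bar>x$1\<bar> (x$2) powr of_real \<nu>)"
    unfolding saddle_def by (rule abs_Im_le_cmod)
  also have "\<dots> = norm x powr \<nu>"
    by (simp add: norm_powr_real_powr' norm_fold)
  finally show ?thesis .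
qed

text \<open>The right-hand side has the shape \<open>C * norm x powr a\<close> that the domination
  lemmas expect. At the origin \<open>0 powr 0\<close> is 0, but \<open>saddle \<nu>\<close>
  vanishes there as well.\<close>

lemma abs_saddle_le_ball:
  assumes "\<nu> \<ge> 0" "x \<in> ball 0 1"
  shows "norm (saddle \<nu> x) \<le> 1 * norm x powr 0"
proof -
  have "norm x powr \<nu> \<le> norm x powr 0"
    using assms by (intro powr_mono') auto
  then show ?thesis using abs_saddle_le[of \<nu> x] by simp
qed

lemma borel_measurable_saddle: "\<nu> > 0 \<Longrightarrow> saddle \<nu> \<in> borel_measurable borel"
  by (intro borel_measurable_continuous_onI continuous_on_saddle)

text \<open>The gradient is dominated by \<open>\<nu> * norm x powr (\<nu> - 1)\<close>, which is
  square integrable in the plane since \<open>\<nu> - 1 > -1\<close>. The weak gradient identity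
  comes from integrating along lines.\<close>

lemma in_W12_saddle:
  assumes \<nu>: "0 < \<nu>" "\<nu> < 1"
  shows "in_W12 (ball 0 1) (saddle \<nu>) (Dsaddle \<nu>)"
proof -
  have int: "set_integrable lborel (ball 0 1) (saddle \<nu>)"
    using \<nu> by (intro set_integrable_ball_bound[OF _ _ _ abs_saddle_le_ball] borel_measurable_saddle) auto
  have D: "Dsaddle \<nu> \<in> borel_measurable borel" using \<nu> by simp
  have Dint: "set_integrable lborel (ball 0 1) (Dsaddle \<nu>)"
    using \<nu> by (intro set_integrable_ball_bound[OF D, of "\<nu> - 1" \<nu>] norm_Dsaddle_le) auto
  have Dint': "set_integrable lborel (ball 0 1) (\<lambda>x. Dsaddle \<nu> x $ i)" for i
  proof (rule set_integrable_ball_bound)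
    show "(\<lambda>x. Dsaddle \<nu> x $ i) \<in> borel_measurable borel" by (rule measurable_compose[OF D borel_measurable_vec_nth])
    show "norm (Dsaddle \<nu> x $ i) \<le> \<nu> * norm x powr (\<nu> - 1)" for x
      using norm_Dsaddle_le[of \<nu> x] component_le_norm_cart[of "Dsaddle \<nu> x" i] \<nu> by simp
  qed (use \<nu> in auto)
  have "saddle \<nu> \<in> Lp_on 2 (ball 0 1)"
    using \<nu> by (intro Lp_on_2_ball_bound[OF _ _ _ _ abs_saddle_le_ball] borel_measurable_saddle) auto
  moreover have "Dsaddle \<nu> \<in> Lp_on 2 (ball 0 1)"
    using \<nu> by (intro Lp_on_2_ball_bound[OF D, of "\<nu> - 1" \<nu>] norm_Dsaddle_le) auto
  moreover have "has_weak_gradient (ball 0 1) (saddle \<nu>) (Dsaddle \<nu>)"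
    unfolding has_weak_gradient_def
  proof (intro conjI allI impI ballI)
    fix K :: "(real^2) set" assume K: "compact K \<and> K \<subseteq> ball 0 1"
    then have "K \<in> sets lebesgue"
      using lmeasurable_compact fmeasurableD by blast
    then show "set_integrable lebesgue K (saddle \<nu>)" "set_integrable lebesgue K (Dsaddle \<nu>)"
      using K set_integrable_lborel_imp_lebesgue[OF int] set_integrable_lborel_imp_lebesgue[OF Dint]
      by (auto intro: set_integrable_subset)
  next
    fix \<phi> :: "real^2 \<Rightarrow> real" and i :: 2
    assume \<phi>: "\<phi> \<in> test_functions (ball 0 1)"
    show "(LINT x:ball 0 1|lebesgue. saddle \<nu> x * partial_deriv i \<phi> x)
        = - (LINT x:ball 0 1|lebesgue. Dsaddle \<nu> x $ i * \<phi> x)"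
    proof (rule weak_partial_deriv_by_lines[OF \<phi> int Dint'])
      show "continuous_on UNIV (\<lambda>t. saddle \<nu> (pt i t s))" for s
        using \<nu> by (intro continuous_on_compose2[OF continuous_on_saddle] continuous_intros) auto
    qed (rule saddle_line_deriv)
  qed
  ultimately show ?thesis
    by (simp add: in_W12_def)
qed

lemma weak_solution_saddle:
  assumes \<nu>: "0 < \<nu>" "\<nu> < 1" and M: "cos (\<nu> * pi / 2) = M * sin (\<nu> * pi / 2)"
    and d: "\<And>x. d x = M * (if x$1 * x$2 \<ge> 0 then 1 else -1)"
  shows "weak_solution
       (\<lambda>x. vector [vector [1, 0], vector [0, 1]] + vector [vector [0, d x], vector [- d x, 0]])
       (ball 0 1) (saddle \<nu>) (Dsaddle \<nu>)"
  unfolding weak_solution_def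
proof (intro conjI ballI in_W12_saddle \<nu>)
  fix \<phi> :: "real^2 \<Rightarrow> real"
  assume \<phi>: "\<phi> \<in> test_functions (ball 0 1)"
  define s where "s = sin (\<nu> * pi / 2)"
  have s: "s > 0"
    unfolding s_def using \<nu> by (intro sin_gt_zero) (auto simp: field_simps)
  let ?w = "\<lambda>x. saddle \<nu> (swap x)"
  let ?D = "\<lambda>i x. Dsaddle \<nu> (swap x) $ i"
  have D: "Dsaddle \<nu> \<in> borel_measurable borel" using \<nu> by simp
  have int: "set_integrable lborel (ball 0 1) ?w"
  proof (rule set_integrable_ball_bound[where C=1 and a=0])
    show "?w \<in> borel_measurable borel"
      using \<nu> by (intro measurable_compose[OF borel_measurable_swap] borel_measurable_saddle)
    show "norm (?w x) \<le> 1 * norm x powr 0" if "x \<in> ball 0 1" for x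
      using abs_saddle_le_ball[of \<nu> "swap x"] \<nu> that by simp
  qed auto
  have Dint: "set_integrable lborel (ball 0 1) (?D i)" for i
  proof (rule set_integrable_ball_bound)
    have "(\<lambda>x. Dsaddle \<nu> (swap x)) \<in> borel_measurable borel"
      by (rule measurable_compose[OF borel_measurable_swap D])
    then show "?D i \<in> borel_measurable borel" by (rule measurable_compose[OF _ borel_measurable_vec_nth])
    show "norm (?D i x) \<le> \<nu> * norm x powr (\<nu> - 1)" for x
      using norm_Dsaddle_le[of \<nu> "swap x"] component_le_norm_cart[of "Dsaddle \<nu> (swap x)" i] \<nu>
      by simp
  qed (use \<nu> in auto)
  \<comment> \<open>The mirror exchanges the coordinates, so the derivative of \<open>?w\<close> in
    direction \<open>i\<close> is the other component \<open>j\<close> of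
    \<open>Dsaddle \<nu>\<close> at the mirrored point.\<close>
  have weak: "(LINT x:ball 0 1|lebesgue. ?w x * partial_deriv i \<psi> x)
        = - (LINT x:ball 0 1|lebesgue. ?D j x * \<psi> x)"
    if \<psi>: "\<psi> \<in> test_functions (ball 0 1)" and ij: "i \<noteq> j" for \<psi> and i j :: 2
  proof -
    show ?thesis
    proof (rule weak_partial_deriv_by_lines[OF \<psi> int Dint])
      show "continuous_on UNIV (\<lambda>t. ?w (pt i t s))" for s
        unfolding swap_pt[OF ij] using \<nu> by (intro continuous_on_compose2[OF continuous_on_saddle] continuous_intros) auto
      show "((\<lambda>t. ?w (pt i t s)) has_real_derivative ?D j (pt i t s)) (at t)" if "s \<noteq> 0" "t \<noteq> 0" for s t
        unfolding swap_pt[OF ij] using that by (rule saddle_line_deriv)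
    qed
  qed
  note p = test_functions_partial_deriv[OF \<phi>]
  \<comment> \<open>Both integrals equal minus the integral of \<open>?w\<close> against a mixed
    second derivative of \<phi>. This expresses that a rotated gradient is divergence free.\<close>
  have "(LINT x:ball 0 1|lebesgue. ?D 1 x * partial_deriv 1 \<phi> x)
      = - (LINT x:ball 0 1|lebesgue. ?w x * partial_deriv 2 (partial_deriv 1 \<phi>) x)"
    using weak[OF p, of 2 1 1] by simp
  also have "partial_deriv 2 (partial_deriv 1 \<phi>) = partial_deriv 1 (partial_deriv 2 \<phi>)"
    using partial_deriv_commute[of \<phi>] \<phi> by (auto simp: test_functions_def fun_eq_iff simp del: Ck.simps)
  also have "- (LINT x:ball 0 1|lebesgue. ?w x * partial_deriv 1 (partial_deriv 2 \<phi>) x)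
      = (LINT x:ball 0 1|lebesgue. ?D 2 x * partial_deriv 2 \<phi> x)"
    using weak[OF p, of 1 2 2] by simp
  finally have eq: "(LINT x:ball 0 1|lebesgue. ?D 1 x * partial_deriv 1 \<phi> x)
      = (LINT x:ball 0 1|lebesgue. ?D 2 x * partial_deriv 2 \<phi> x)" .
  let ?A = "\<lambda>x. vector [vector [1, 0], vector [0, 1]] + vector [vector [0, d x], vector [- d x, 0]] :: real^2^2"
  have inner: "(?A x *v Dsaddle \<nu> x) \<bullet> grad \<phi> x
      = (Dsaddle \<nu> x $ 1 + d x * Dsaddle \<nu> x $ 2) * partial_deriv 1 \<phi> x
        + (Dsaddle \<nu> x $ 2 - d x * Dsaddle \<nu> x $ 1) * partial_deriv 2 \<phi> x" for x
    by (simp add: inner_vec_def sum_2 matrix_vector_mult_def grad_def)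
  have "AE x in lborel. (?A x *v Dsaddle \<nu> x) \<bullet> grad \<phi> x
      = (1 / s) * (?D 2 x * partial_deriv 2 \<phi> x - ?D 1 x * partial_deriv 1 \<phi> x)"
    using AE_lborel_coord_nonzero[of 1] AE_lborel_coord_nonzero[of 2]
  proof eventually_elim
    case (elim x)
    \<comment> \<open>On the axes \<open>d\<close> is \<open>M\<close> while \<open>sgn\<close>
      gives 0, so this formula is used only almost everywhere.\<close>
    have dx: "d x = M * sgn (x$1 * x$2)" using elim by (auto simp: d sgn_if)
    have "?D 1 x = - s * (Dsaddle \<nu> x $ 1 + d x * Dsaddle \<nu> x $ 2)"
      "?D 2 x = s * (Dsaddle \<nu> x $ 2 - d x * Dsaddle \<nu> x $ 1)"
      using Dsaddle_flux[OF elim, of \<nu>, unfolded M] by (simp_all add: dx s_def algebra_simps)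
    then show ?case
      unfolding inner using s by (simp add: divide_simps) (simp add: algebra_simps)
  qed
  then have ae: "AE x in lebesgue. indicator (ball 0 1) x *\<^sub>R ((?A x *v Dsaddle \<nu> x) \<bullet> grad \<phi> x)
      = (1 / s) * (indicator (ball 0 1) x *\<^sub>R (?D 2 x * partial_deriv 2 \<phi> x)
         - indicator (ball 0 1) x *\<^sub>R (?D 1 x * partial_deriv 1 \<phi> x))"
    by (intro AE_completion) (auto elim!: eventually_mono simp: indicator_def)
  have i: "integrable lebesgue (\<lambda>x. indicator (ball 0 1) x *\<^sub>R (?D i x * partial_deriv i \<phi> x))" for i
    using set_lebesgue_integral_test_function(2)[OF p Dint] by (simp add: set_integrable_def)
  let ?R = "\<lambda>x. (1 / s) * (indicator (ball 0 1) x *\<^sub>R (?D 2 x * partial_deriv 2 \<phi> x)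
         - indicator (ball 0 1) x *\<^sub>R (?D 1 x * partial_deriv 1 \<phi> x))"
  have R: "integrable lebesgue ?R"
    by (intro integrable_mult_right Bochner_Integration.integrable_diff i)
  have meas: "(\<lambda>x. indicator (ball 0 1) x *\<^sub>R ((?A x *v Dsaddle \<nu> x) \<bullet> grad \<phi> x)) \<in> borel_measurable lebesgue"
  proof (rule measurable_completion)
    have [measurable]: "(\<lambda>x. Dsaddle \<nu> x $ i) \<in> borel_measurable borel"
      "partial_deriv i \<phi> \<in> borel_measurable borel" for i
      by (rule measurable_compose[OF D borel_measurable_vec_nth])
        (intro borel_measurable_continuous_onI test_function_continuous[OF p])
    have [measurable]: "d \<in> borel_measurable borel"
      unfolding d by measurable
    have [measurable]: "ball 0 1 \<in> sets (borel :: (real^2) measure)" by simp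
    show "(\<lambda>x. indicator (ball 0 1) x *\<^sub>R ((?A x *v Dsaddle \<nu> x) \<bullet> grad \<phi> x)) \<in> borel_measurable lborel"
      unfolding inner by measurable
  qed
  have "(LINT x:ball 0 1|lebesgue. (?A x *v Dsaddle \<nu> x) \<bullet> grad \<phi> x) = integral\<^sup>L lebesgue ?R"
    unfolding set_lebesgue_integral_def
    by (rule integral_cong_AE[OF meas borel_measurable_integrable[OF R] ae])
  also have "\<dots> = 0"
    using eq i by (simp add: set_lebesgue_integral_def)
  finally show "(LINT x:ball 0 1|lebesgue. (?A x *v Dsaddle \<nu> x) \<bullet> grad \<phi> x) = 0" .
qed

section \<open>Failure of higher integrability\<close>

text \<open>On the ball of radius \<open>r\<close> the function is almost everywhere at least
  \<open>c * r powr (- q)\<close>, so the integral would be at least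
  \<open>c * K * r powr (DIM('a) - q)\<close>. This is unbounded as \<open>r\<close> tends to 0
  because \<open>q\<close> strictly exceeds the dimension.\<close>

lemma not_integrable_ball_powr:
  fixes f :: "'a::euclidean_space \<Rightarrow> real" and c q R :: real
  assumes "c > 0" "q > DIM('a)" "R > 0"
    and lower: "AE x in lebesgue. c * norm x powr (- q) \<le> f x"
  shows "\<not> integrable (lebesgue_on (ball 0 R)) f"
proof
  assume "integrable (lebesgue_on (ball 0 R)) f"
  then have int: "integrable lebesgue (\<lambda>x. indicator (ball 0 R) x *\<^sub>R f x)"
    by (simp add: integrable_restrict_space)
  define K where "K = measure lebesgue (ball (0::'a) 1)"
  have K: "K > 0" by (simp add: K_def)
  define I where "I = (\<integral>x. indicator (ball 0 R) x *\<^sub>R f x \<partial>lebesgue)"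
  have bound: "c * K * r powr (DIM('a) - q) \<le> I" if r: "0 < r" "r < R" for r
  proof -
    have "(\<integral>x. indicator (ball 0 r) x *\<^sub>R (c * r powr (- q)) \<partial>(lebesgue :: 'a measure)) \<le> I"
      unfolding I_def
    proof (rule integral_mono_AE[OF _ int])
      show "integrable lebesgue (\<lambda>x::'a. indicat_real (ball 0 r) x *\<^sub>R (c * r powr - q))"
        by (intro integrable_scaleR_left integrable_real_indicator) (auto simp: emeasure_lborel_ball_finite[unfolded infinity_ennreal_def])
      show "AE x in lebesgue. indicat_real (ball 0 r) x *\<^sub>R (c * r powr - q) \<le> indicat_real (ball 0 R) x *\<^sub>R f x"
        using lower AE_completion[OF AE_lborel_singleton[of 0]]
      proof eventually_elim
        case (elim x)
        show ?case
        proof (cases "x \<in> ball 0 r")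
          case True
          then have "r powr - q \<le> norm x powr - q"
            using elim assms by (intro powr_mono2') auto
          then have "c * r powr - q \<le> c * norm x powr - q" using assms by simp
          with elim True r show ?thesis by simp
        next
          case False
          have "0 \<le> f x" using elim(1) assms by (smt (verit) mult_nonneg_nonneg powr_ge_zero)
          with False show ?thesis by simp
        qed
      qed
    qed
    also have "(\<integral>x. indicator (ball 0 r) x *\<^sub>R (c * r powr (- q)) \<partial>(lebesgue :: 'a measure))
        = measure lebesgue (ball (0::'a) r) * (c * r powr (- q))"
      by simp
    also have "measure lebesgue (ball (0::'a) r) = r powr DIM('a) * K"
      using content_ball_conv_unit_ball[of r "0::'a"] r by (simp add: K_def powr_realpow)
    finally show ?thesis by (simp add: powr_diff powr_minus field_simps)
  qed
  define e where "e = q - DIM('a)"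
  have e: "e > 0" and minus_e: "DIM('a) - q = - e" using assms by (simp_all add: e_def)
  \<comment> \<open>The radius \<open>r = T powr (- 1 / e)\<close> turns the lower bound into
    \<open>c * K * T\<close>, so a large \<open>T\<close> gives the contradiction.\<close>
  have "((\<lambda>T::real. T powr (- 1 / e)) \<longlongrightarrow> 0) at_top"
    using e by (intro tendsto_neg_powr filterlim_ident) auto
  then have "eventually (\<lambda>T::real. T powr (- 1 / e) < R) at_top"
    using \<open>R > 0\<close> by (rule order_tendstoD)
  then have "eventually (\<lambda>T::real. T powr (- 1 / e) < R \<and> T > 0 \<and> T > I / (c * K)) at_top"
    by (intro eventually_conj eventually_gt_at_top)
  then obtain T where T: "T powr (- 1 / e) < R" "T > 0" "T > I / (c * K)"
    by (auto dest: eventually_happens)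
  have "(T powr (- 1 / e)) powr (DIM('a) - q) = T"
    using e T unfolding minus_e by (simp add: powr_powr)
  then have "c * K * T \<le> I" using bound[of "T powr (- 1 / e)"] T by simp
  with T(3) K \<open>c > 0\<close> show False by (simp add: field_simps)
qed

text \<open>The \<open>p\<close>-th power of the gradient behaves like the norm to the power
  \<open>- ((1 - \<nu>) * p)\<close>, and \<open>(1 - \<nu>) * p > (1 - \<mu>) * p \<ge> 2\<close>.
  The strict inequality \<open>\<nu> < \<mu>\<close> covers the borderline exponent.\<close>

lemma Dsaddle_not_Lp:
  assumes \<nu>: "0 < \<nu>" "\<nu> < \<mu>" and "\<mu> < 1" and "R > 0" and p: "p \<ge> ereal (2 / (1 - \<mu>))"
  shows "Dsaddle \<nu> \<notin> Lp_on p (ball 0 R)"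
proof -
  have *: "\<not> integrable (lebesgue_on (ball 0 R)) (\<lambda>x. norm (Dsaddle \<nu> x) powr r)" if r: "r \<ge> 2 / (1 - \<mu>)" for r
  proof (rule not_integrable_ball_powr)
    have r0: "r > 0" using r \<open>\<mu> < 1\<close> by (smt (verit) divide_pos_pos)
    show "\<nu> powr r > 0" using \<nu> by simp
    have "2 \<le> (1 - \<mu>) * r" using r \<open>\<mu> < 1\<close> by (simp add: field_simps)
    also have "\<dots> < (1 - \<nu>) * r" using \<nu> r0 by simp
    finally show "real DIM(real^2) < (1 - \<nu>) * r" by simp
    show "AE x in lebesgue. \<nu> powr r * norm x powr (- ((1 - \<nu>) * r)) \<le> norm (Dsaddle \<nu> x) powr r"
      using AE_completion[OF AE_lborel_coord_nonzero[of 1]]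
    proof eventually_elim
      case (elim x)
      then have "norm (Dsaddle \<nu> x) powr r = \<nu> powr r * norm x powr ((\<nu> - 1) * r)"
        using norm_Dsaddle[of \<nu> x] \<nu> by (simp add: powr_mult powr_powr)
      then show ?case by (simp add: algebra_simps)
    qed
  qed fact
  show ?thesis
  proof (cases p)
    case (real r)
    then show ?thesis using p *[of r] by (simp add: Lp_on_def)
  next
    case PInf
    show ?thesis
    proof
      assume "Dsaddle \<nu> \<in> Lp_on p (ball 0 R)"
      with PInf have m: "Dsaddle \<nu> \<in> borel_measurable (lebesgue_on (ball 0 R))"
        and lt: "esssup (lebesgue_on (ball 0 R)) (\<lambda>x. ereal (norm (Dsaddle \<nu> x))) < \<infinity>"
        by (auto simp: Lp_on_def)
      obtain B where "esssup (lebesgue_on (ball 0 R)) (\<lambda>x. ereal (norm (Dsaddle \<nu> x))) \<le> ereal B"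
        using lt by (cases "esssup (lebesgue_on (ball 0 R)) (\<lambda>x. ereal (norm (Dsaddle \<nu> x)))") auto
      then have B: "AE x in lebesgue_on (ball 0 R). norm (Dsaddle \<nu> x) \<le> B"
        using esssup_AE[of "\<lambda>x. ereal (norm (Dsaddle \<nu> x))" "lebesgue_on (ball 0 R)"]
        by (auto elim!: eventually_mono dest: order_trans)
      let ?r = "2 / (1 - \<mu>)"
      interpret finite_measure "lebesgue_on (ball (0::real^2) R)"
        by (rule finite_measure_lebesgue_on) simp
      \<comment> \<open>The ball has finite measure, so an essentially bounded gradient would also
        lie in the space with the finite critical exponent.\<close>
      have "integrable (lebesgue_on (ball 0 R)) (\<lambda>x. norm (Dsaddle \<nu> x) powr ?r)"
      proof (rule integrable_const_bound)
        show "AE x in lebesgue_on (ball 0 R). norm (norm (Dsaddle \<nu> x) powr ?r) \<le> B powr ?r"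
          using B \<open>\<mu> < 1\<close> by (auto elim!: eventually_mono intro!: powr_mono2)
        show "(\<lambda>x. norm (Dsaddle \<nu> x) powr ?r) \<in> borel_measurable (lebesgue_on (ball 0 R))"
          using m by measurable
      qed
      with * show False by blast
    qed
  next
    case MInf
    with p show ?thesis by simp
  qed
qed

section \<open>Failure of Hoelder continuity\<close>

text \<open>Replacing \<open>x\<close> by \<open>- x\<close> conjugates the folded point
  \<open>Complex \<bar>x$1\<bar> (x$2)\<close>. Oddness makes the pair \<open>x\<close>,
  \<open>- x\<close> a good test of Hoelder continuity.\<close>

lemma saddle_minus: "saddle \<nu> (- x) = - saddle \<nu> x"
  using cnj_powr[of "Complex \<bar>x$1\<bar> (x$2)" "of_real \<nu>"]
  by (simp add: saddle_def complex_cnj complex_eq_iff)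

lemma saddle_axis:
  assumes "t > 0"
  shows "saddle \<nu> (pt 2 t 0) = t powr \<nu> * sin (\<nu> * pi / 2)"
proof -
  have "Complex 0 t = \<i> * of_real t" by (simp add: complex_eq_iff)
  then have "Complex 0 t powr of_real \<nu> = cis (\<nu> * pi / 2) * of_real (t powr \<nu>)"
    using assms powr_of_real_rotate[of "of_real t" \<nu>] by (simp add: powr_of_real)
  then show ?thesis by (simp add: saddle_def)
qed

text \<open>At scale \<open>t\<close> the values at suitable \<open>x\<close> and \<open>- x\<close>
  differ by at least a multiple of \<open>t powr \<nu>\<close>, while the Hoelder condition permits
  only a multiple of \<open>t powr \<alpha>\<close>. As \<open>\<nu> < \<alpha>\<close>, this fails
  for small \<open>t\<close>.\<close>

lemma saddle_not_holder:
  assumes \<nu>: "0 < \<nu>" "\<nu> < 1" "\<nu> < \<alpha>" and "R > 0"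
  shows "\<not> in_holder \<alpha> (ball 0 R) (saddle \<nu>)"
proof
  assume "in_holder \<alpha> (ball 0 R) (saddle \<nu>)"
  then obtain v C where ae: "AE x in lebesgue_on (ball 0 R). v x = saddle \<nu> x"
    and C: "\<And>x y. x \<in> ball 0 R \<Longrightarrow> y \<in> ball 0 R \<Longrightarrow> \<bar>v x - v y\<bar> \<le> C * dist x y powr \<alpha>"
    unfolding in_holder_def by blast
  define N where "N = {x \<in> ball 0 R. v x \<noteq> saddle \<nu> x}"
  have "AE x in lebesgue. x \<in> ball 0 R \<longrightarrow> v x = saddle \<nu> x"
    using ae by (simp add: AE_restrict_space_iff)
  then have N: "negligible N"
    unfolding N_def by (auto simp: negligible_iff_null_sets eventually_ae_filter intro: completion.complete2)
  have N': "negligible (uminus ` N)"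
    by (rule negligible_differentiable_image_negligible[OF _ N]) (auto intro!: derivative_intros)
  \<comment> \<open>At height \<open>t/2\<close> on the vertical axis \<open>saddle \<nu>\<close>
    equals \<open>2 * c * t powr \<nu>\<close>. Half of that value is the threshold in
    \<open>U\<close> below, so \<open>U\<close> contains this point.\<close>
  define c where "c = (1/2) powr \<nu> * sin (\<nu> * pi / 2) / 2"
  have c: "c > 0"
    unfolding c_def using \<nu> by (intro divide_pos_pos mult_pos_pos sin_gt_zero) (auto simp: field_simps)
  have key: "2 * c * t powr \<nu> \<le> \<bar>C\<bar> * (2 * t) powr \<alpha>" if t: "0 < t" "t < R" for t
  proof -
    define U where "U = {x \<in> ball 0 t. c * t powr \<nu> < saddle \<nu> x}"
    have "open U"
    proof -
      have "open {x. c * t powr \<nu> < saddle \<nu> x}"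
        using \<nu> by (intro open_Collect_less continuous_on_saddle continuous_intros) auto
      moreover have "U = ball 0 t \<inter> {x. c * t powr \<nu> < saddle \<nu> x}" by (auto simp: U_def)
      ultimately show ?thesis by auto
    qed
    moreover have "pt 2 (t/2) 0 \<in> U"
    proof -
      have "saddle \<nu> (pt 2 (t/2) 0) = 2 * c * t powr \<nu>"
        using t by (simp add: saddle_axis c_def powr_divide)
      then show ?thesis using c t by (simp add: U_def norm_pt)
    qed
    \<comment> \<open>The representative \<open>v\<close> is known only almost everywhere. The
      nonempty open set \<open>U\<close> cannot be covered by \<open>N\<close> and its reflection,
      so some \<open>x\<close> in \<open>U\<close> has good values at both \<open>x\<close> and
      \<open>- x\<close>.\<close>
    ultimately have "\<not> negligible U" using open_not_negligible by blast
    moreover have "negligible (N \<union> uminus ` N)" using N N' by simp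
    ultimately obtain x where x: "x \<in> U" "x \<notin> N" "x \<notin> uminus ` N"
      using negligible_subset by (metis UnCI subsetI)
    have "- x \<notin> N" using x(3) by force
    have R: "x \<in> ball 0 R" "- x \<in> ball 0 R" using x(1) t by (auto simp: U_def)
    have v: "v x = saddle \<nu> x" "v (- x) = - saddle \<nu> x"
      using x(2) \<open>- x \<notin> N\<close> R by (auto simp: N_def saddle_minus)
    have "2 * c * t powr \<nu> \<le> \<bar>v x - v (- x)\<bar>"
      using x(1) unfolding v U_def by (simp add: abs_if)
    also have "\<dots> \<le> C * dist x (- x) powr \<alpha>" by (rule C[OF R])
    also have "\<dots> \<le> \<bar>C\<bar> * dist x (- x) powr \<alpha>" by (intro mult_right_mono) auto
    also have "\<dots> \<le> \<bar>C\<bar> * (2 * t) powr \<alpha>"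
    proof -
      have "dist x (- x) = 2 * norm x" by (simp add: dist_norm flip: scaleR_2)
      then show ?thesis using x(1) \<nu> by (intro mult_left_mono powr_mono2) (auto simp: U_def)
    qed
    finally show ?thesis .
  qed
  \<comment> \<open>Here \<open>T = 1 / t\<close>, so letting \<open>t\<close> tend to 0 becomes a
    limit at infinity.\<close>
  have "((\<lambda>T::real. \<bar>C\<bar> * 2 powr \<alpha> * T powr (\<nu> - \<alpha>)) \<longlongrightarrow> \<bar>C\<bar> * 2 powr \<alpha> * 0) at_top"
    using \<nu> by (intro tendsto_mult tendsto_const tendsto_neg_powr filterlim_ident) auto
  then have "eventually (\<lambda>T::real. \<bar>C\<bar> * 2 powr \<alpha> * T powr (\<nu> - \<alpha>) < 2 * c) at_top"
    using c by (intro order_tendstoD) auto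
  then have "eventually (\<lambda>T::real. \<bar>C\<bar> * 2 powr \<alpha> * T powr (\<nu> - \<alpha>) < 2 * c \<and> T > 0 \<and> T > 1 / R) at_top"
    by (intro eventually_conj eventually_gt_at_top)
  then obtain T where T: "\<bar>C\<bar> * 2 powr \<alpha> * T powr (\<nu> - \<alpha>) < 2 * c" "T > 0" "T > 1 / R"
    by (auto dest: eventually_happens)
  have "2 * c * (1 / T) powr \<nu> \<le> \<bar>C\<bar> * (2 * (1 / T)) powr \<alpha>"
    using T \<open>R > 0\<close> by (intro key) (auto simp: field_simps)
  then have "2 * c / T powr \<nu> \<le> \<bar>C\<bar> * 2 powr \<alpha> / T powr \<alpha>"
    using T by (simp add: powr_divide)
  then have "2 * c \<le> \<bar>C\<bar> * 2 powr \<alpha> * T powr (\<nu> - \<alpha>)"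
    using T by (simp add: powr_diff field_simps)
  with T(1) show False by simp
qed

section \<open>Choice of the exponent\<close>

text \<open>Jordan's inequality in strict form: \<open>cos\<close> decreases, so by the mean value
  theorem the chord of \<open>sin\<close> over the interval from 0 to \<open>x\<close> is steeper
  than the chord from \<open>x\<close> to \<open>pi / 2\<close>.\<close>

lemma sin_ge_chord:
  assumes "0 < x" "x < pi / 2"
  shows "2 * x / pi < sin x"
proof -
  obtain y where y: "0 < y" "y < x" "sin x = x * cos y"
    using MVT2[OF \<open>0 < x\<close> DERIV_sin] by auto
  obtain z where z: "x < z" "z < pi / 2" "1 - sin x = (pi / 2 - x) * cos z"
    using MVT2[OF \<open>x < pi / 2\<close> DERIV_sin] by auto
  have "cos z < cos y" using y z by (intro cos_monotone_0_pi) auto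
  then have "(1 - sin x) * x < sin x * (pi / 2 - x)"
    using y z assms by simp
  then show ?thesis by (simp add: field_simps)
qed

lemma checkerboard_exponent:
  fixes \<mu> :: real
  assumes "0 < \<mu>" "\<mu> < 1"
  defines "M \<equiv> pi * (1 - \<mu>\<^sup>2) / (2 * \<mu>)"
  obtains \<nu> where "0 < \<nu>" "\<nu> < \<mu>" "cos (\<nu> * pi / 2) = M * sin (\<nu> * pi / 2)"
proof
  \<comment> \<open>The solution of \<open>tan (\<nu> * pi / 2) = 1 / M\<close>. Then
    \<open>\<nu> < \<mu>\<close> amounts to \<open>cos x < M * sin x\<close> at
    \<open>x = \<mu> * pi / 2\<close>, which the chain below proves using
    \<open>M * \<mu> = (1 - \<mu>) * pi / 2 * (1 + \<mu>)\<close>.\<close>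
  define \<nu> where "\<nu> = 2 / pi * arctan (1 / M)"
  have "\<mu>\<^sup>2 < 1" using assms by (simp add: power_less_one_iff)
  then have M: "M > 0" using assms by simp
  have \<nu>: "\<nu> * pi / 2 = arctan (1 / M)" by (simp add: \<nu>_def)
  show "0 < \<nu>" using M by (simp add: \<nu>_def)
  show "cos (\<nu> * pi / 2) = M * sin (\<nu> * pi / 2)"
    unfolding \<nu> using M by (simp add: cos_arctan sin_arctan)
  define x where "x = \<mu> * pi / 2"
  have x: "0 < x" "x < pi / 2" using assms by (auto simp: x_def)
  have "cos x = sin ((1 - \<mu>) * pi / 2)"
    by (simp add: cos_sin_eq x_def field_simps)
  also have "\<dots> \<le> (1 - \<mu>) * pi / 2"
    using assms by (intro sin_x_le_x) auto
  also have "\<dots> < (1 - \<mu>) * pi / 2 * (1 + \<mu>)"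
    using assms by simp
  also have "\<dots> = M * \<mu>"
    using assms by (simp add: M_def field_simps power2_eq_square)
  also have "\<dots> < M * sin x"
    using M sin_ge_chord[OF x] by (simp add: x_def)
  finally have "cos x < M * sin x" .
  then have "1 / M < tan x"
    using M x cos_gt_zero[of x] by (simp add: tan_def field_simps)
  then have "arctan (1 / M) < arctan (tan x)" by (rule arctan_monotone)
  also have "\<dots> = x" using x by (intro arctan_tan) auto
  finally show "\<nu> < \<mu>" by (simp add: \<nu>_def x_def field_simps)
qed

theorem theorem1p2:
  fixes \<mu> :: real
  assumes "0 < \<mu>" and "\<mu> < 1"
  shows "\<exists>(d :: real^2 \<Rightarrow> real) (u :: real^2 \<Rightarrow> real) (Du :: real^2 \<Rightarrow> real^2).
     d \<in> borel_measurable lebesgue \<and>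
     esssup lebesgue (\<lambda>x. ereal \<bar>d x\<bar>) = ereal (pi * (1 - \<mu>\<^sup>2) / (2 * \<mu>)) \<and>
     weak_solution
       (\<lambda>x. vector [vector [1, 0], vector [0, 1]] + vector [vector [0, d x], vector [- d x, 0]])
       (ball 0 1) u Du \<and>
     (\<forall>p::ereal. p \<ge> ereal (2 / (1 - \<mu>)) \<longrightarrow> Du \<notin> Lp_on p (ball 0 (1/2))) \<and>
     (\<forall>\<alpha>::real. \<alpha> \<ge> \<mu> \<longrightarrow> \<not> in_holder \<alpha> (ball 0 (1/2)) u)"
proof -
  define M where "M = pi * (1 - \<mu>\<^sup>2) / (2 * \<mu>)"
  obtain \<nu> where \<nu>: "0 < \<nu>" "\<nu> < \<mu>" "cos (\<nu> * pi / 2) = M * sin (\<nu> * pi / 2)"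
    using checkerboard_exponent[OF assms] unfolding M_def by blast
  \<comment> \<open>Taking \<open>\<ge>\<close> assigns \<open>M\<close> to the axes too, so
    \<open>\<bar>d x\<bar>\<close> is constant and its essential supremum is immediate.\<close>
  define d where "d x = M * (if x$1 * x$2 \<ge> 0 then 1 else -1)" for x :: "real^2"
  have "M \<ge> 0" using assms by (simp add: M_def power_le_one)
  then have "\<bar>d x\<bar> = M" for x by (simp add: d_def)
  then have "esssup lebesgue (\<lambda>x. ereal \<bar>d x\<bar>) = ereal M"
    by (simp add: esssup_const)
  moreover have "d \<in> borel_measurable borel"
    unfolding d_def by measurable
  then have "d \<in> borel_measurable lebesgue"
    by (intro measurable_completion) simp
  moreover have "weak_solution
       (\<lambda>x. vector [vector [1, 0], vector [0, 1]] + vector [vector [0, d x], vector [- d x, 0]])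
       (ball 0 1) (saddle \<nu>) (Dsaddle \<nu>)"
    using \<nu> assms by (intro weak_solution_saddle[where M=M]) (auto simp: d_def)
  ultimately show ?thesis
    using \<nu> assms Dsaddle_not_Lp[of \<nu> \<mu> "1/2"] saddle_not_holder[of \<nu> _ "1/2"] unfolding M_def
    by (intro exI[of _ d] exI[of _ "saddle \<nu>"] exI[of _ "Dsaddle \<nu>"]) auto
qed

end
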